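(* Let $j:\mathbf{Sym}\to\mathbf{Sym}\otimes\mathbf{Sym}$ be the algebra morphism determined by $j(\Lambda_n)=\Lambda_n\otimes S_n$ for all $n\ge1$. Then for every composition $K$ of an integer $n$, the image of the ribbon function $R_K$ by $j$ is $$j(R_K)=\sum_{I\backslash J=K}R_I\otimes R_J,$$ where the sum runs over all pairs $(I,J)$ of compositions of $n$ such that $\operatorname{Des}(I)\setminus\operatorname{Des}(J)=\operatorname{Des}(K)$. (In the notation with two mutually commuting alphabets $A,B$ and the virtual alphabet $\mathbb{J}=(A,B)$ with $\Lambda_n(\mathbb{J})=\Lambda_n(A)S_n(B)$, this reads $R_K(\mathbb{J})=\sum_{I\backslash J=K}R_I(A)R_J(B)$.)
   Context: $\mathbf{Sym}=\bigoplus_{n\ge0}\mathbf{Sym}_n$ is the algebra of noncommutative symmetric functions over $\mathbb{C}$: the free associative unital algebra on generators $S_1,S_2,\dots$ with $\deg S_n=n$ (and $S_0=1$). The elementary functions $\Lambda_n$ are defined by $\Lambda_0=1$ and $\sum_{k=0}^n(-1)^k\Lambda_kS_{n-k}=0$ for $n\ge1$; $\mathbf{Sym}$ is also freely generated by $\Lambda_1,\Lambda_2,\dots$. A composition $I=(i_1,\dots,i_r)$ of $n$ is a finite sequence of positive integers with sum $n$; its descent set is $\operatorname{Des}(I)=\{i_1,i_1+i_2,\dots,i_1+\cdots+i_{r-1}\}\subseteq\{1,\dots,n-1\}$, and $l(I)=r$ is its length. Compositions of $n$ correspond bijectively to subsets of $\{1,\dots,n-1\}$ via $\operatorname{Des}$.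 For two compositions $I,J$ of the same integer $n$, $I\backslash J$ denotes the composition of $n$ with $\operatorname{Des}(I\backslash J)=\operatorname{Des}(I)\setminus\operatorname{Des}(J)$ (set difference). Put $S^I=S_{i_1}\cdots S_{i_r}$. The ribbon basis $(R_I)$ of $\mathbf{Sym}$ is defined by $R_I=\sum_{J}(-1)^{l(I)-l(J)}S^J$, where $J$ runs over the compositions of $n$ with $\operatorname{Des}(J)\subseteq\operatorname{Des}(I)$ (so $R_{(n)}=S_n$ and $R_{(1^n)}=\Lambda_n$). The product on $\mathbf{Sym}\otimes\mathbf{Sym}$ is $(F\otimes G)(F'\otimes G')=FF'\otimes GG'$; a tensor $F\otimes G$ is identified with $F(A)G(B)$ for two mutually commuting alphabets $A,B$, and $F(\mathbb{J})$ denotes $j(F)$. *)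

theory Defs
  imports
    Complex_Main
    "HOL-Library.Poly_Mapping"
    "HOL-Library.Product_Plus"
begin

section \<open>Compositions\<close>

text \<open>The empty composition (of the integer 0) is included. Concatenation is written additively
  because the monoid algebra of Poly_Mapping is built on an additively written monoid.\<close>

typedef composition = "{ps :: nat list. 0 \<notin> set ps}"
  morphisms parts Composition
  by (rule exI[of _ "[]"]) simp

setup_lifting type_definition_composition

instantiation composition :: monoid_add
begin

lift_definition zero_composition :: composition is "[]" by simp

lift_definition plus_composition :: "composition \<Rightarrow> composition \<Rightarrow> composition" is "(@)" by simp

instance by standard (transfer, simp)+

end

lemma parts_zero [simp]: "parts 0 = []"
  by transfer simp

lemma parts_plus [simp]: "parts (I + J) = parts I @ parts J"
  by transfer simp

definition weight :: "composition \<Rightarrow> nat"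
  where "weight I = sum_list (parts I)"

definition comp_length :: "composition \<Rightarrow> nat"
  where "comp_length I = length (parts I)"

definition compositions :: "nat \<Rightarrow> composition set"
  where "compositions n = {I. weight I = n}"

definition Des :: "composition \<Rightarrow> nat set"
  where "Des I = {sum_list (take k (parts I)) | k. 1 \<le> k \<and> k < comp_length I}"

lemma finite_compositions [simp, intro]: "finite (compositions n)"
proof -
  have len: "length ps \<le> sum_list ps" if "0 \<notin> set ps" for ps :: "nat list"
    using that by (induction ps) auto
  have "parts ` compositions n \<subseteq> {ps. set ps \<subseteq> {..n} \<and> length ps \<le> n}"
    using len parts member_le_sum_list by (fastforce simp: compositions_def weight_def)
  then have "finite (parts ` compositions n)"
    by (rule finite_subset) (rule finite_lists_length_le, simp)
  then show ?thesis
    by (rule finite_imageD) (simp add: inj_on_def parts_inject)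
qed


section \<open>Noncommutative symmetric functions\<close>

text \<open>The free algebra on the \<open>S\<^sub>n\<close> (\<open>n \<ge> 1\<close>) is the monoid algebra of the free monoid
  on the positive integers, that is, of the monoid of compositions.\<close>

type_synonym Sym = "composition \<Rightarrow>\<^sub>0 complex"

text \<open>The tensor square has the pairs of basis elements as a basis; with the componentwise
  product \<open>(F \<otimes> G) (F' \<otimes> G') = F F' \<otimes> G G'\<close> it is the monoid algebra of the product monoid
  (see \<open>tensor_mult\<close> below).\<close>

type_synonym Sym2 = "composition \<times> composition \<Rightarrow>\<^sub>0 complex"

definition scale :: "complex \<Rightarrow> ('m \<Rightarrow>\<^sub>0 complex) \<Rightarrow> 'm \<Rightarrow>\<^sub>0 complex"
  where "scale c F = Poly_Mapping.map ((*) c) F"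

definition tensor :: "Sym \<Rightarrow> Sym \<Rightarrow> Sym2" (infixl "\<otimes>" 75)
  where "F \<otimes> G = (\<Sum>I\<in>Poly_Mapping.keys F. \<Sum>J\<in>Poly_Mapping.keys G.
    Poly_Mapping.single (I, J) (Poly_Mapping.lookup F I * Poly_Mapping.lookup G J))"

definition algebra_hom ::
  "(('m::monoid_add \<Rightarrow>\<^sub>0 complex) \<Rightarrow> ('k::monoid_add \<Rightarrow>\<^sub>0 complex)) \<Rightarrow> bool"
  where "algebra_hom f \<longleftrightarrow>
    Vector_Spaces.linear scale scale f \<and> f 1 = 1 \<and> (\<forall>x y. f (x * y) = f x * f y)"

definition sym_S :: "nat \<Rightarrow> Sym"
  where "sym_S n = (if n = 0 then 1 else Poly_Mapping.single (Composition [n]) 1)"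

text \<open>The defining relation \<open>\<Sum>k\<le>n. (-1)^k \<Lambda>\<^sub>k S\<^bsub>n-k\<^esub> = 0\<close> solved for \<open>\<Lambda>\<^sub>n\<close>; see
  \<open>sym_Lambda_relation\<close>.\<close>

fun sym_Lambda :: "nat \<Rightarrow> Sym"
  where "sym_Lambda n =
    (if n = 0 then 1 else (-1) ^ (n + 1) * (\<Sum>k<n. (-1) ^ k * sym_Lambda k * sym_S (n - k)))"

declare sym_Lambda.simps [simp del]

definition S_prod :: "composition \<Rightarrow> Sym"
  where "S_prod I = prod_list (map sym_S (parts I))"

text \<open>In each summand \<open>comp_length J \<le> comp_length I\<close>, so the subtraction does not truncate.\<close>

definition ribbon :: "composition \<Rightarrow> Sym"
  where "ribbon I = (\<Sum>J\<in>{J \<in> compositions (weight I). Des J \<subseteq> Des I}.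
    (-1) ^ (comp_length I - comp_length J) * S_prod J)"


section \<open>Consistency of the definitions\<close>

lemma lookup_scale [simp]: "Poly_Mapping.lookup (scale c F) k = c * Poly_Mapping.lookup F k"
  unfolding scale_def by (simp add: map.rep_eq when_def)

lemma vector_space_scale: "vector_space (scale :: complex \<Rightarrow> ('m \<Rightarrow>\<^sub>0 complex) \<Rightarrow> _)"
  by standard (auto intro!: poly_mapping_eqI simp: lookup_add algebra_simps)

lemma scale_single [simp]:
  "scale c (Poly_Mapping.single k d) = Poly_Mapping.single k (c * d)"
  by (auto intro!: poly_mapping_eqI simp: lookup_single when_def)

lemma scale_add: "scale c (F + G) = scale c F + scale c G"
  by (auto intro!: poly_mapping_eqI simp: lookup_add algebra_simps)

lemma scale_zero [simp]: "scale c 0 = 0"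
  by (auto intro!: poly_mapping_eqI)

lemma scale_scale [simp]: "scale c (scale d F) = scale (c * d) F"
  by (auto intro!: poly_mapping_eqI)

lemma scale_sum: "scale c (sum f A) = (\<Sum>a\<in>A. scale c (f a))"
  by (auto intro!: poly_mapping_eqI simp: lookup_sum sum_distrib_left)

lemma poly_mapping_sum_single:
  "F = (\<Sum>k\<in>Poly_Mapping.keys F. Poly_Mapping.single k (Poly_Mapping.lookup F k))"
proof (rule poly_mapping_eqI)
  fix k
  show "Poly_Mapping.lookup F k = Poly_Mapping.lookup
      (\<Sum>k\<in>Poly_Mapping.keys F. Poly_Mapping.single k (Poly_Mapping.lookup F k)) k"
    by (simp add: lookup_sum lookup_single when_def sum.delta in_keys_iff)
qed

lemma poly_mapping_single_induct [case_names zero single add]: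
  fixes F :: "'m \<Rightarrow>\<^sub>0 complex"
  assumes "P 0" "\<And>k c. P (Poly_Mapping.single k c)" "\<And>F G. P F \<Longrightarrow> P G \<Longrightarrow> P (F + G)"
  shows "P F"
proof -
  have "P (sum f A)" if "finite A" "\<And>a. a \<in> A \<Longrightarrow> P (f a)" for f :: "'m \<Rightarrow> 'm \<Rightarrow>\<^sub>0 complex" and A
    using that by (induction A) (auto intro: assms)
  then have "P (\<Sum>k\<in>Poly_Mapping.keys F. Poly_Mapping.single k (Poly_Mapping.lookup F k))"
    by (simp add: assms(2))
  then show ?thesis
    by (simp flip: poly_mapping_sum_single)
qed

lemma scale_mult_left:
  fixes F G :: "'m::monoid_add \<Rightarrow>\<^sub>0 complex"
  shows "scale c F * G = scale c (F * G)"
  by (simp add: scale_def mult_map_scale_conv_mult mult.assoc)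

lemma scale_mult_right:
  fixes F G :: "'m::monoid_add \<Rightarrow>\<^sub>0 complex"
  shows "F * scale c G = scale c (F * G)"
proof -
  have "F * Poly_Mapping.single 0 c = Poly_Mapping.single 0 c * F"
    by (induction F rule: poly_mapping_single_induct)
      (auto simp: mult_single algebra_simps)
  then show ?thesis
    by (metis scale_def mult_map_scale_conv_mult mult.assoc)
qed

lemma lookup_tensor:
  "Poly_Mapping.lookup (F \<otimes> G) (I, J) = Poly_Mapping.lookup F I * Poly_Mapping.lookup G J"
proof -
  have "Poly_Mapping.lookup (F \<otimes> G) (I, J) =
      (\<Sum>I'\<in>Poly_Mapping.keys F. \<Sum>J'\<in>Poly_Mapping.keys G. if J' = J
        then (if I' = I then Poly_Mapping.lookup F I' * Poly_Mapping.lookup G J' else 0) else 0)"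
    unfolding tensor_def lookup_sum
    by (intro sum.cong refl) (auto simp: lookup_single when_def)
  also have "\<dots> = Poly_Mapping.lookup F I * Poly_Mapping.lookup G J"
    by (cases "Poly_Mapping.lookup G J = 0") (simp_all add: sum.delta in_keys_iff)
  finally show ?thesis .
qed

lemma tensor_add_left: "(F + F') \<otimes> G = F \<otimes> G + F' \<otimes> G"
  by (rule poly_mapping_eqI) (auto simp: lookup_tensor lookup_add algebra_simps split_paired_all)

lemma tensor_add_right: "F \<otimes> (G + G') = F \<otimes> G + F \<otimes> G'"
  by (rule poly_mapping_eqI) (auto simp: lookup_tensor lookup_add algebra_simps split_paired_all)

lemma tensor_scale_left: "scale c F \<otimes> G = scale c (F \<otimes> G)"
  by (rule poly_mapping_eqI) (auto simp: lookup_tensor split_paired_all)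

lemma tensor_scale_right: "F \<otimes> scale c G = scale c (F \<otimes> G)"
  by (rule poly_mapping_eqI) (auto simp: lookup_tensor split_paired_all)

lemma tensor_zero [simp]: "0 \<otimes> G = 0" "F \<otimes> 0 = 0"
  by (simp_all add: tensor_def)

lemma tensor_single:
  "Poly_Mapping.single I c \<otimes> Poly_Mapping.single J d = Poly_Mapping.single (I, J) (c * d)"
  by (rule poly_mapping_eqI) (auto simp: lookup_tensor lookup_single when_def split_paired_all)

lemma tensor_one: "1 \<otimes> 1 = 1"
  by (simp flip: single_one add: tensor_single zero_prod_def)

lemma tensor_mult: "(F \<otimes> G) * (F' \<otimes> G') = (F * F') \<otimes> (G * G')"
proof (induction F rule: poly_mapping_single_induct)
  case F: (single I c)
  show ?case
  proof (induction F' rule: poly_mapping_single_induct)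
    case F': (single I' c')
    show ?case
    proof (induction G rule: poly_mapping_single_induct)
      case G: (single J d)
      show ?case
        by (induction G' rule: poly_mapping_single_induct)
          (auto simp: tensor_single mult_single tensor_add_right algebra_simps)
    qed (auto simp: tensor_add_right algebra_simps)
  qed (auto simp: tensor_add_left algebra_simps)
qed (auto simp: tensor_add_left algebra_simps)

lemma sym_Lambda_0: "sym_Lambda 0 = 1"
  by (simp add: sym_Lambda.simps)

lemma minus_one_power_square: "(-1) ^ n * ((-1) ^ n * x) = (x :: 'a::ring_1)"
  by (simp flip: mult.assoc power_add mult_2)

lemma sym_Lambda_relation:
  assumes "n \<ge> 1"
  shows "(\<Sum>k\<le>n. (-1) ^ k * sym_Lambda k * sym_S (n - k)) = 0"
proof -
  have "(\<Sum>k\<le>n. (-1) ^ k * sym_Lambda k * sym_S (n - k)) =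
      (\<Sum>k<n. (-1) ^ k * sym_Lambda k * sym_S (n - k)) + (-1) ^ n * sym_Lambda n"
    by (simp flip: lessThan_Suc_atMost add: sym_S_def)
  also have "\<dots> = 0"
    using assms by (subst (2) sym_Lambda.simps) (simp add: minus_one_power_square)
  finally show ?thesis .
qed

lemma parts_Composition: "n \<noteq> 0 \<Longrightarrow> parts (Composition [n]) = [n]"
  by (simp add: Composition_inverse)

lemma composition_Cons:
  assumes "parts I = n # ns"
  obtains J where "I = Composition [n] + J" "n \<noteq> 0" "parts J = ns"
proof
  have *: "0 \<notin> set (n # ns)" using parts[of I] assms by simp
  then show "n \<noteq> 0" by simp
  show "parts (Composition ns) = ns" using * by (simp add: Composition_inverse)
  show "I = Composition [n] + Composition ns"
    using * assms by (subst parts_inject[symmetric]) (simp add: Composition_inverse)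
qed

lemma S_prod_eq_single: "S_prod I = Poly_Mapping.single I 1"
proof (induction "parts I" arbitrary: I)
  case Nil
  then have "I = 0" by (metis parts_inject parts_zero)
  then show ?case by (simp add: S_prod_def)
next
  case (Cons n ns)
  obtain J where J: "I = Composition [n] + J" "n \<noteq> 0" "parts J = ns"
    using composition_Cons[of I n ns] Cons(2) by metis
  have "S_prod J = Poly_Mapping.single J 1" using Cons(1) J by simp
  then show ?case
    using J by (simp add: S_prod_def parts_Composition sym_S_def mult_single)
qed

text \<open>The rest shows that there is exactly one algebra morphism sending each \<open>\<Lambda>\<^sub>m\<close> to
  \<open>\<Lambda>\<^sub>m \<otimes> S\<^sub>m\<close>.\<close>

definition free_hom :: "(nat \<Rightarrow> 'k::monoid_add \<Rightarrow>\<^sub>0 complex) \<Rightarrow> Sym \<Rightarrow> 'k \<Rightarrow>\<^sub>0 complex"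
  where "free_hom g F = (\<Sum>I\<in>Poly_Mapping.keys F.
    scale (Poly_Mapping.lookup F I) (prod_list (map g (parts I))))"

lemma free_hom_superset:
  assumes "finite A" "Poly_Mapping.keys F \<subseteq> A"
  shows "free_hom g F = (\<Sum>I\<in>A. scale (Poly_Mapping.lookup F I) (prod_list (map g (parts I))))"
  unfolding free_hom_def
  by (rule sum.mono_neutral_left) (use assms in \<open>auto simp: in_keys_iff intro!: poly_mapping_eqI\<close>)

lemma free_hom_single: "free_hom g (Poly_Mapping.single I c) = scale c (prod_list (map g (parts I)))"
  by (subst free_hom_superset[of "{I}"]) auto

lemma free_hom_add: "free_hom g (F + G) = free_hom g F + free_hom g G"
proof -
  let ?A = "Poly_Mapping.keys F \<union> Poly_Mapping.keys G"
  have "Poly_Mapping.keys (F + G) \<subseteq> ?A" by (rule keys_add)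
  then show ?thesis
    by (subst (1 2 3) free_hom_superset[of ?A])
      (auto simp: lookup_add lookup_sum algebra_simps sum.distrib intro!: poly_mapping_eqI)
qed

lemma free_hom_scale: "free_hom g (scale c F) = scale c (free_hom g F)"
  by (induction F rule: poly_mapping_single_induct)
    (auto simp: free_hom_single free_hom_add scale_add, simp add: free_hom_def)

lemma free_hom_mult: "free_hom g (F * G) = free_hom g F * free_hom g G"
proof (induction F rule: poly_mapping_single_induct)
  case zero
  show ?case by (simp add: free_hom_def)
next
  case F: (single I c)
  show ?case
  proof (induction G rule: poly_mapping_single_induct)
    case zero
    show ?case by (simp add: free_hom_def)
  next
    case (single J d)
    show ?case
      by (simp add: mult_single free_hom_single scale_mult_left scale_mult_right mult.commute)
  qed (simp add: free_hom_add algebra_simps)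
qed (simp add: free_hom_add algebra_simps)

lemma free_hom_one: "free_hom g 1 = 1"
  by (simp flip: single_one add: free_hom_single)

lemma algebra_hom_free_hom: "algebra_hom (free_hom g)"
proof -
  have "Vector_Spaces.linear scale scale (free_hom g)"
    by (intro Vector_Spaces.linear.intro vector_space_scale module_hom.intro module_hom_axioms.intro
        module.intro) (auto intro!: poly_mapping_eqI simp: free_hom_add free_hom_scale lookup_add algebra_simps)
  then show ?thesis
    by (simp add: algebra_hom_def free_hom_one free_hom_mult)
qed

lemma free_hom_S: "n \<ge> 1 \<Longrightarrow> free_hom g (sym_S n) = g n"
  by (simp add: sym_S_def free_hom_single parts_Composition) (auto intro!: poly_mapping_eqI)

lemma free_hom_S0: "free_hom g (sym_S 0) = 1"
  by (simp add: sym_S_def free_hom_one)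

lemma algebra_homD:
  assumes "algebra_hom f"
  shows "f (F + G) = f F + f G" "f (scale c F) = scale c (f F)" "f 1 = 1" "f (F * G) = f F * f G"
    "f 0 = 0" "f (- F) = - f F" "f (sum h A) = (\<Sum>a\<in>A. f (h a))" "f ((-1) ^ k) = (-1) ^ k"
proof -
  interpret Vector_Spaces.linear scale scale f
    using assms by (simp add: algebra_hom_def)
  show "f (F + G) = f F + f G" "f (scale c F) = scale c (f F)" "f 0 = 0" "f (- F) = - f F"
    "f (sum h A) = (\<Sum>a\<in>A. f (h a))"
    by (fact add scale zero neg sum)+
  show "f 1 = 1" and m: "f (F * G) = f F * f G" for F G
    using assms by (auto simp: algebra_hom_def)
  show "f ((-1) ^ k) = (-1) ^ k"
    by (induction k) (use assms in \<open>auto simp: algebra_hom_def neg\<close>)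
qed

lemma algebra_hom_ext:
  fixes f g :: "Sym \<Rightarrow> 'k::monoid_add \<Rightarrow>\<^sub>0 complex"
  assumes f: "algebra_hom f" and g: "algebra_hom g" and eq: "\<And>n. f (sym_S n) = g (sym_S n)"
  shows "f = g"
proof
  fix F
  have prod: "f (prod_list (map sym_S ns)) = g (prod_list (map sym_S ns))" for ns
    by (induction ns) (simp_all add: algebra_homD[OF f] algebra_homD[OF g] eq)
  show "f F = g F"
  proof (induction F rule: poly_mapping_single_induct)
    case (single I c)
    have "Poly_Mapping.single I c = scale c (S_prod I)"
      by (simp add: S_prod_eq_single)
    then show ?case
      using prod by (simp add: algebra_homD[OF f] algebra_homD[OF g] S_prod_def)
  qed (simp_all add: algebra_homD[OF f] algebra_homD[OF g])
qed

text \<open>The images of the \<open>S\<^sub>n\<close>, obtained by applying the morphism to \<open>sym_Lambda_relation\<close>.\<close>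

fun jS :: "nat \<Rightarrow> Sym2"
  where "jS n = (if n = 0 then 1 else
    - (\<Sum>k<n. (-1) ^ (n - k) * (sym_Lambda (n - k) \<otimes> sym_S (n - k)) * jS k))"

declare jS.simps [simp del]

lemma jS_relation:
  assumes "n \<ge> 1"
  shows "(\<Sum>k\<le>n. (-1) ^ k * (sym_Lambda k \<otimes> sym_S k) * jS (n - k)) = 0"
proof -
  have "(\<Sum>k\<le>n. (-1) ^ k * (sym_Lambda k \<otimes> sym_S k) * jS (n - k)) =
      (\<Sum>k\<le>n. (-1) ^ (n - k) * (sym_Lambda (n - k) \<otimes> sym_S (n - k)) * jS k)"
    by (rule sum.reindex_bij_witness[of _ "\<lambda>k. n - k" "\<lambda>k. n - k"]) auto
  also have "\<dots> = (\<Sum>k<n. (-1) ^ (n - k) * (sym_Lambda (n - k) \<otimes> sym_S (n - k)) * jS k) + jS n"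
    by (simp flip: lessThan_Suc_atMost add: sym_Lambda_0 sym_S_def tensor_one)
  also have "\<dots> = 0"
    using assms by (subst (2) jS.simps) simp
  finally show ?thesis .
qed

theorem ex1_morphism:
  "\<exists>!j. algebra_hom j \<and> (\<forall>m\<ge>1. j (sym_Lambda m) = sym_Lambda m \<otimes> sym_S m)"
proof (rule ex_ex1I)
  let ?j = "free_hom jS"
  have hom: "algebra_hom ?j" by (rule algebra_hom_free_hom)
  have jS: "?j (sym_S n) = jS n" for n
    by (cases "n = 0") (simp_all add: free_hom_S0 free_hom_S jS.simps[of 0])
  have "?j (sym_Lambda n) = sym_Lambda n \<otimes> sym_S n" for n
  proof (induction n rule: less_induct)
    case (less n)
    show ?case
    proof (cases "n = 0")
      case True
      then show ?thesis by (simp add: sym_Lambda_0 sym_S_def tensor_one free_hom_one)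
    next
      case False
      have "?j (\<Sum>k\<le>n. (-1) ^ k * sym_Lambda k * sym_S (n - k)) = 0"
        using False by (subst sym_Lambda_relation) (simp_all add: algebra_homD(5)[OF hom])
      then have "(\<Sum>k\<le>n. (-1) ^ k * ?j (sym_Lambda k) * jS (n - k)) = 0"
        by (simp add: algebra_homD[OF hom] jS)
      then have "(\<Sum>k<n. (-1) ^ k * ?j (sym_Lambda k) * jS (n - k)) +
          (-1) ^ n * ?j (sym_Lambda n) = 0"
        by (simp flip: lessThan_Suc_atMost add: jS.simps[of 0])
      moreover have "(\<Sum>k<n. (-1) ^ k * (sym_Lambda k \<otimes> sym_S k) * jS (n - k)) +
          (-1) ^ n * (sym_Lambda n \<otimes> sym_S n) = 0"
        using jS_relation[of n] False
        by (simp flip: lessThan_Suc_atMost add: jS.simps[of 0])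
      ultimately have "(-1) ^ n * ?j (sym_Lambda n) = (-1) ^ n * (sym_Lambda n \<otimes> sym_S n)"
        using less by (simp add: add_eq_0_iff)
      then show ?thesis by (metis minus_one_power_square)
    qed
  qed
  then show "\<exists>j. algebra_hom j \<and> (\<forall>m\<ge>1. j (sym_Lambda m) = sym_Lambda m \<otimes> sym_S m)"
    using hom by blast
next
  fix f g :: "Sym \<Rightarrow> Sym2"
  assume "algebra_hom f \<and> (\<forall>m\<ge>1. f (sym_Lambda m) = sym_Lambda m \<otimes> sym_S m)"
    and "algebra_hom g \<and> (\<forall>m\<ge>1. g (sym_Lambda m) = sym_Lambda m \<otimes> sym_S m)"
  then have f: "algebra_hom f" and g: "algebra_hom g"
    and L: "\<And>m. m \<ge> 1 \<Longrightarrow> f (sym_Lambda m) = g (sym_Lambda m)"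
    by simp_all
  have L0: "f (sym_Lambda m) = g (sym_Lambda m)" for m
    using L[of m] by (cases "m = 0") (simp_all add: sym_Lambda_0 algebra_homD[OF f] algebra_homD[OF g])
  have "f (sym_S n) = g (sym_S n)" for n
  proof (induction n rule: less_induct)
    case (less n)
    show ?case
    proof (cases "n = 0")
      case True
      then show ?thesis by (simp add: sym_S_def algebra_homD[OF f] algebra_homD[OF g])
    next
      case False
      have rel: "h (sym_S n) +
          (\<Sum>k\<in>{..n} - {0}. (-1) ^ k * h (sym_Lambda k) * h (sym_S (n - k))) = 0"
        if h: "algebra_hom h" for h :: "Sym \<Rightarrow> Sym2"
      proof -
        have "h (\<Sum>k\<le>n. (-1) ^ k * sym_Lambda k * sym_S (n - k)) = 0"
          using False by (subst sym_Lambda_relation) (simp_all add: algebra_homD(5)[OF h])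
        then have "(\<Sum>k\<le>n. (-1) ^ k * h (sym_Lambda k) * h (sym_S (n - k))) = 0"
          by (simp add: algebra_homD[OF h])
        then show ?thesis
          by (subst (asm) sum.remove[of _ 0]) (simp_all add: sym_Lambda_0 algebra_homD[OF h])
      qed
      have "(\<Sum>k\<in>{..n} - {0}. (-1) ^ k * f (sym_Lambda k) * f (sym_S (n - k))) =
          (\<Sum>k\<in>{..n} - {0}. (-1) ^ k * g (sym_Lambda k) * g (sym_S (n - k)))"
        using less False by (intro sum.cong) (auto simp: L0)
      then show ?thesis
        using rel[OF f] rel[OF g] by (simp add: eq_neg_iff_add_eq_0[symmetric])
    qed
  qed
  then show "f = g" by (rule algebra_hom_ext[OF f g])
qed

end

theory Submission
  imports Defs
begin

text \<open>
  Let \<open>\<Lambda>\<^sup>K\<close> be the product of the \<open>\<Lambda>\<^sub>k\<close> over the parts \<open>k\<close> of a composition \<open>K\<close> of \<open>n\<close>, and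
  write \<open>U = {1..<n}\<close>. On descent sets, the products \<open>S\<^sup>K\<close> and \<open>\<Lambda>\<^sup>K\<close> are sums of ribbons over a
  lower and an upper interval of the Boolean lattice of subsets of \<open>U\<close>: the ribbons \<open>R\<^sub>J\<close> with
  \<open>Des J \<subseteq> Des K\<close> (\<open>S_prod_eq_sum_ribbon\<close>) and the \<open>R\<^sub>I\<close> with \<open>U - Des K \<subseteq> Des I\<close>
  (\<open>Lambda_prod_eq_sum_ribbon\<close>), respectively.

  The morphism \<open>j\<close> is multiplicative, so it sends \<open>\<Lambda>\<^sup>K\<close> to \<open>\<Lambda>\<^sup>K \<otimes> S\<^sup>K\<close>, which is the sum of
  \<open>R\<^sub>I \<otimes> R\<^sub>J\<close> over the pairs with \<open>U - Des K \<subseteq> Des I\<close> and \<open>Des J\<close> disjoint from \<open>U - Des K\<close>. These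
  two conditions together say exactly that \<open>U - Des K \<subseteq> Des I - Des J\<close>. Therefore \<open>j R\<^sub>L\<close> and the
  sum of \<open>R\<^sub>I \<otimes> R\<^sub>J\<close> over the pairs with \<open>Des I - Des J = Des L\<close> agree after summation over all \<open>L\<close>
  with \<open>U - Des K \<subseteq> Des L\<close>, for every \<open>K\<close>. This system of equations is unitriangular with respect
  to inclusion of descent sets, so the two families agree term by term.

  The expansion of \<open>S\<^sup>K\<close> is Moebius inversion of the definition of the ribbons. That of \<open>\<Lambda>\<^sup>K\<close> is the
  same inversion applied to the expansion of \<open>\<Lambda>\<^sup>K\<close> as an alternating sum of the \<open>S\<^sup>J\<close> over the
  refinements \<open>J\<close> of \<open>K\<close> (\<open>Lambda_prod_eq_sum_S_prod\<close>). Both use that \<open>Des\<close> is a bijection from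
  the compositions of \<open>n\<close> to the subsets of \<open>U\<close> (\<open>bij_betw_Des\<close>).
\<close>


section \<open>Compositions and their descent sets\<close>

lemma weight_zero [simp]: "weight 0 = 0"
  by (simp add: weight_def)

lemma weight_plus [simp]: "weight (I + J) = weight I + weight J"
  by (simp add: weight_def)

lemma weight_singleton [simp]: "p \<noteq> 0 \<Longrightarrow> weight (Composition [p]) = p"
  by (simp add: weight_def parts_Composition)

lemma comp_length_zero [simp]: "comp_length 0 = 0"
  by (simp add: comp_length_def)

lemma comp_length_plus [simp]: "comp_length (I + J) = comp_length I + comp_length J"
  by (simp add: comp_length_def)

lemma comp_length_singleton [simp]: "p \<noteq> 0 \<Longrightarrow> comp_length (Composition [p]) = 1"
  by (simp add: comp_length_def parts_Composition)

lemma weight_eq_0_iff [simp]: "weight I = 0 \<longleftrightarrow> I = 0"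
proof
  assume "weight I = 0"
  then have "\<forall>x\<in>set (parts I). x = 0" by (simp add: weight_def)
  then have "parts I = []" using parts[of I] by (cases "parts I") auto
  then show "I = 0" by (metis parts_inject parts_zero)
qed simp

lemma singleton_neq_0 [simp]: "p \<noteq> 0 \<Longrightarrow> Composition [p] \<noteq> 0"
  by (metis weight_singleton weight_zero)

lemma composition_rev_induct [case_names zero snoc]:
  assumes "P 0" "\<And>I p. P I \<Longrightarrow> p \<noteq> 0 \<Longrightarrow> P (I + Composition [p])"
  shows "P I"
proof (induction "parts I" arbitrary: I rule: rev_induct)
  case Nil
  then have "I = 0" by (metis parts_inject parts_zero)
  then show ?case using assms(1) by simp
next
  case (snoc p ps)
  have *: "0 \<notin> set (ps @ [p])" using parts[of I] snoc(2) by simp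
  then have ps: "parts (Composition ps) = ps" by (simp add: Composition_inverse)
  then have "parts I = parts (Composition ps + Composition [p])"
    using * snoc(2)[symmetric] by (simp add: parts_Composition)
  then have "I = Composition ps + Composition [p]" by (simp only: parts_inject)
  then show ?case using assms(2) snoc(1) ps * by simp
qed

lemma composition_rev_cases [case_names zero snoc]:
  obtains "I = 0" | J p where "I = J + Composition [p]" "p \<noteq> 0"
  by (induction I rule: composition_rev_induct) auto

text \<open>Equidivisibility of the free monoid: of two factorizations of the same composition, one cuts
  no later than the other. As a rewrite rule it loops.\<close>

lemma composition_plus_eq_plus_iff:
  fixes I J A B :: composition
  shows "I + J = A + B \<longleftrightarrow> (\<exists>C. I = A + C \<and> C + J = B \<or> I + C = A \<and> J = C + B)"
proof
  assume "I + J = A + B"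
  then have "parts I @ parts J = parts A @ parts B" by (metis parts_plus)
  then obtain us where us: "parts I = parts A @ us \<and> us @ parts J = parts B
      \<or> parts I @ us = parts A \<and> parts J = us @ parts B"
    by (auto simp: append_eq_append_conv2)
  then have "0 \<notin> set us" using parts[of I] parts[of J] parts[of A] parts[of B]
    by (auto dest!: arg_cong[of _ _ set])
  then have "parts (Composition us) = us" by (simp add: Composition_inverse)
  with us show "\<exists>C. I = A + C \<and> C + J = B \<or> I + C = A \<and> J = C + B"
    by (intro exI[of _ "Composition us"]) (metis parts_inject parts_plus)
qed (auto simp: add.assoc)

text \<open>The index-free form of the descent set: the weights of the proper nonempty prefixes. It
  lets decompositions be compared through equations in the free monoid.\<close>

lemma Des_iff: "x \<in> Des I \<longleftrightarrow> (\<exists>A B. I = A + B \<and> A \<noteq> 0 \<and> B \<noteq> 0 \<and> x = weight A)"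
proof
  assume "x \<in> Des I"
  then obtain k where k: "x = sum_list (take k (parts I))" "1 \<le> k" "k < length (parts I)"
    by (auto simp: Des_def comp_length_def)
  let ?A = "Composition (take k (parts I))" and ?B = "Composition (drop k (parts I))"
  have A: "parts ?A = take k (parts I)" and B: "parts ?B = drop k (parts I)"
    using parts[of I] by (auto intro!: Composition_inverse dest: in_set_takeD in_set_dropD)
  have "I = ?A + ?B" by (metis A B append_take_drop_id parts_inject parts_plus)
  moreover have "?A \<noteq> 0" "?B \<noteq> 0" using A B k by fastforce+
  ultimately show "\<exists>A B. I = A + B \<and> A \<noteq> 0 \<and> B \<noteq> 0 \<and> x = weight A"
    using k(1) A by (metis weight_def)
next
  assume "\<exists>A B. I = A + B \<and> A \<noteq> 0 \<and> B \<noteq> 0 \<and> x = weight A"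
  then obtain A B where AB: "I = A + B" "A \<noteq> 0" "B \<noteq> 0" "x = weight A" by blast
  then have "parts A \<noteq> []" "parts B \<noteq> []" by (metis parts_inject parts_zero)+
  then show "x \<in> Des I" using AB
    by (auto simp: Des_def comp_length_def weight_def Suc_le_eq intro!: exI[of _ "length (parts A)"])
qed

lemma Des_subset: "Des I \<subseteq> {1..<weight I}"
  by (auto simp: Des_iff Suc_le_eq simp flip: neq0_conv)

lemma finite_Des [simp]: "finite (Des I)"
  using Des_subset finite_subset by blast

lemma Des_zero [simp]: "Des 0 = {}"
  using Des_subset[of 0] by simp

lemma Des_singleton [simp]: "p \<noteq> 0 \<Longrightarrow> Des (Composition [p]) = {}"
  by (simp add: Des_def comp_length_def parts_Composition)

lemma weight_in_Des_plus: "I \<noteq> 0 \<Longrightarrow> J \<noteq> 0 \<Longrightarrow> weight I \<in> Des (I + J)"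
  by (auto simp: Des_iff)

text \<open>A prefix of \<open>I + J\<close> that is lighter than \<open>I\<close> is a proper prefix of \<open>I\<close>.\<close>

lemma Des_plus_less:
  assumes "J \<noteq> 0"
  shows "Des (I + J) \<inter> {..<weight I} = Des I"
proof (intro equalityI subsetI)
  fix x assume "x \<in> Des (I + J) \<inter> {..<weight I}"
  then obtain A B where AB: "I + J = A + B" "A \<noteq> 0" "x = weight A" "weight A < weight I"
    by (auto simp: Des_iff)
  then obtain C where "I = A + C" by (auto simp: composition_plus_eq_plus_iff)
  moreover from this have "C \<noteq> 0" using AB(4) by auto
  ultimately show "x \<in> Des I" using AB by (auto simp: Des_iff)
next
  fix x assume x: "x \<in> Des I"
  then obtain A B where "I = A + B" "A \<noteq> 0" "B \<noteq> 0" "x = weight A" by (auto simp: Des_iff)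
  moreover from this have "I + J = A + (B + J)" by (simp add: add.assoc)
  moreover have "B + J \<noteq> 0" using assms by (metis add_is_0 weight_eq_0_iff weight_plus)
  ultimately have "x \<in> Des (I + J)" unfolding Des_iff by metis
  then show "x \<in> Des (I + J) \<inter> {..<weight I}" using x Des_subset[of I] by auto
qed

lemma Des_snoc:
  assumes "I \<noteq> 0" "p \<noteq> 0"
  shows "Des (I + Composition [p]) = insert (weight I) (Des I)"
proof -
  let ?K = "I + Composition [p]"
  have "x \<le> weight I" if x: "x \<in> Des ?K" for x
  proof -
    obtain A B where AB: "?K = A + B" "B \<noteq> 0" "x = weight A"
      using x by (auto simp: Des_iff)
    obtain B' q where B: "B = B' + Composition [q]" "q \<noteq> 0"
      using AB(2) by (cases B rule: composition_rev_cases) auto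
    have "parts I @ [p] = (parts A @ parts B') @ [q]"
      using AB(1) B assms by (metis add.assoc parts_plus parts_Composition)
    then have "I = A + B'" by (metis append1_eq_conv parts_inject parts_plus)
    then show ?thesis using AB by simp
  qed
  then have "Des ?K \<subseteq> insert (weight I) (Des ?K \<inter> {..<weight I})"
    by fastforce
  moreover have "weight I \<in> Des ?K" using assms by (simp add: weight_in_Des_plus)
  moreover have "Des ?K \<inter> {..<weight I} = Des I" using assms by (simp add: Des_plus_less)
  ultimately show ?thesis by auto
qed

lemma comp_length_eq: "I \<noteq> 0 \<Longrightarrow> comp_length I = Suc (card (Des I))"
proof (induction I rule: composition_rev_induct)
  case (snoc I p)
  have "weight I \<notin> Des I" using Des_subset[of I] by auto
  with snoc show ?case by (cases "I = 0") (simp_all add: Des_snoc)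
qed simp

text \<open>The last part of a composition is found from its weight and the greatest descent, and
  removing it removes that descent; both injectivity and surjectivity follow by recursion.\<close>

lemma Des_inject: "weight I = weight J \<Longrightarrow> Des I = Des J \<Longrightarrow> I = J"
proof (induction I arbitrary: J rule: composition_rev_induct)
  case zero
  then show ?case by (metis weight_eq_0_iff)
next
  case (snoc I p)
  obtain J' q where J: "J = J' + Composition [q]" "q \<noteq> 0"
    using snoc.hyps snoc.prems by (cases J rule: composition_rev_cases) auto
  have ends: "weight I \<notin> Des I" "weight J' \<notin> Des J'" "\<forall>x\<in>Des I. x < weight I"
      "\<forall>x\<in>Des J'. x < weight J'"
    using Des_subset[of I] Des_subset[of J'] by auto
  have "I = J'"
  proof (cases "I = 0 \<or> J' = 0")
    case True
    with snoc J show ?thesis by (metis Des_singleton Des_snoc add_0 insert_not_empty)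
  next
    case False
    then have eq: "insert (weight I) (Des I) = insert (weight J') (Des J')"
      using snoc J by (simp add: Des_snoc)
    then have w: "weight I = weight J'" using ends by (metis insert_iff less_asym)
    with eq ends have "Des I = Des J'" by (metis insert_ident)
    with w snoc.IH show ?thesis by simp
  qed
  with snoc J show ?case by simp
qed

lemma Des_surj: "D \<subseteq> {1..<n} \<Longrightarrow> \<exists>I. weight I = n \<and> Des I = D"
proof (induction n arbitrary: D rule: less_induct)
  case (less n)
  have fin: "finite D" using less.prems finite_subset by blast
  show ?case
  proof (cases "D = {}")
    case True
    then show ?thesis
      by (cases "n = 0") (auto intro: exI[of _ 0] exI[of _ "Composition [n]"])
  next
    case False
    define m where "m = Max D"
    have mD: "m \<in> D" using False fin by (simp add: m_def)
    then have m: "1 \<le> m" "m < n" using less.prems by auto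
    have "D - {m} \<subseteq> {1..<m}"
    proof
      fix x assume x: "x \<in> D - {m}"
      then have "x \<le> m" using fin by (simp add: m_def)
      with x less.prems show "x \<in> {1..<m}" by auto
    qed
    then obtain I where I: "weight I = m" "Des I = D - {m}" using less.IH m by blast
    moreover have "I \<noteq> 0" using I(1) m(1) by (metis weight_zero not_one_le_zero)
    ultimately show ?thesis using m mD
      by (intro exI[of _ "I + Composition [n - m]"]) (auto simp: Des_snoc)
  qed
qed

lemma bij_betw_Des: "bij_betw Des (compositions n) (Pow {1..<n})"
proof (rule bij_betw_imageI)
  show "inj_on Des (compositions n)"
    by (auto simp: inj_on_def compositions_def intro: Des_inject)
  show "Des ` compositions n = Pow {1..<n}"
  proof
    show "Des ` compositions n \<subseteq> Pow {1..<n}"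
      unfolding compositions_def using Des_subset by blast
    show "Pow {1..<n} \<subseteq> Des ` compositions n"
    proof
      fix D assume "D \<in> Pow {1..<n}"
      then obtain I where "weight I = n" "Des I = D" using Des_surj by blast
      then show "D \<in> Des ` compositions n" by (auto simp: compositions_def)
    qed
  qed
qed

lemma bij_betw_plus_compositions:
  assumes "m \<noteq> 0" "p \<noteq> 0"
  shows "bij_betw (\<lambda>(J, L). J + L) (compositions m \<times> compositions p)
    {I \<in> compositions (m + p). m \<in> Des I}"
proof (rule bij_betw_imageI)
  show "inj_on (\<lambda>(J, L). J + L) (compositions m \<times> compositions p)"
  proof (rule inj_onI, clarsimp simp: compositions_def)
    fix J L J' L'
    assume "J + L = J' + L'" "weight J' = weight J" "weight L' = weight L"
    then show "J = J' \<and> L = L'"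
      using composition_plus_eq_plus_iff[of J L J' L'] by (metis add_cancel_right_right
          add.left_neutral add.right_neutral weight_eq_0_iff weight_plus)
  qed
  show "(\<lambda>(J, L). J + L) ` (compositions m \<times> compositions p) = {I \<in> compositions (m + p). m \<in> Des I}"
  proof (intro equalityI subsetI)
    fix I assume "I \<in> (\<lambda>(J, L). J + L) ` (compositions m \<times> compositions p)"
    then show "I \<in> {I \<in> compositions (m + p). m \<in> Des I}"
      using assms by (auto simp: compositions_def intro: weight_in_Des_plus)
  next
    fix I assume "I \<in> {I \<in> compositions (m + p). m \<in> Des I}"
    then obtain J L where "I = J + L" "weight J = m" "weight L = p"
      by (auto simp: compositions_def Des_iff)
    then show "I \<in> (\<lambda>(J, L). J + L) ` (compositions m \<times> compositions p)"
      by (intro image_eqI[of _ _ "(J, L)"]) (auto simp: compositions_def)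
  qed
qed

text \<open>Splitting off the last part mirrors the recursion for \<open>\<Lambda>\<^sub>n\<close>, whose summands end in a
  factor \<open>S\<^bsub>n-k\<^esub>\<close>.\<close>

lemma bij_betw_snoc_compositions:
  assumes "n \<noteq> 0"
  shows "bij_betw (\<lambda>(k, J). J + Composition [n - k]) (SIGMA k:{..<n}. compositions k) (compositions n)"
proof (rule bij_betw_imageI)
  show "inj_on (\<lambda>(k, J). J + Composition [n - k]) (SIGMA k:{..<n}. compositions k)"
  proof (rule inj_onI, clarsimp simp: compositions_def)
    fix I J
    assume "weight I < n" "weight J < n"
      and "I + Composition [n - weight I] = J + Composition [n - weight J]"
    then have "parts I @ [n - weight I] = parts J @ [n - weight J]"
      by (metis parts_plus parts_Composition zero_less_diff less_not_refl2)
    then show "weight I = weight J \<and> I = J" by (simp add: parts_inject)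
  qed
  show "(\<lambda>(k, J). J + Composition [n - k]) ` (SIGMA k:{..<n}. compositions k) = compositions n"
  proof (intro equalityI subsetI)
    fix I assume I: "I \<in> compositions n"
    then obtain J p where "I = J + Composition [p]" "p \<noteq> 0"
      using assms by (cases I rule: composition_rev_cases) (auto simp: compositions_def)
    with I show "I \<in> (\<lambda>(k, J). J + Composition [n - k]) ` (SIGMA k:{..<n}. compositions k)"
      by (intro image_eqI[of _ _ "(weight J, J)"]) (auto simp: compositions_def)
  qed (auto simp: compositions_def)
qed


section \<open>Moebius inversion on descent sets\<close>

lemma sum_Pow_alternating:
  "finite A \<Longrightarrow> (\<Sum>X\<in>Pow A. (-1) ^ card X) = (if A = {} then 1 else 0 :: 'a::ring_1)"
proof (induction A rule: finite_induct)
  case (insert x A)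
  have inj: "inj_on (insert x) (Pow A)"
    using insert by (auto simp: inj_on_def)
  have card: "card (insert x X) = Suc (card X)" if "X \<in> Pow A" for X
    using that insert finite_subset[of X A] by (auto intro!: card_insert_disjoint)
  have "(\<Sum>X\<in>Pow (insert x A). (-1) ^ card X) =
      (\<Sum>X\<in>Pow A. (-1) ^ card X) + (\<Sum>X\<in>Pow A. (-1) ^ card (insert x X) :: 'a)"
    unfolding Pow_insert using insert
    by (subst sum.union_disjoint) (auto simp: sum.reindex[OF inj])
  also have "(\<Sum>X\<in>Pow A. (-1) ^ card (insert x X)) = - (\<Sum>X\<in>Pow A. (-1) ^ card X :: 'a)"
    by (simp add: card sum_negf)
  finally show ?case by simp
qed simp

lemma sum_interval_alternating:
  assumes "finite B" "A \<subseteq> B"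
  shows "(\<Sum>X | A \<subseteq> X \<and> X \<subseteq> B. (-1) ^ card X) = (if A = B then (-1) ^ card A else 0 :: 'a::ring_1)"
proof -
  have "(\<Sum>X | A \<subseteq> X \<and> X \<subseteq> B. (-1) ^ card X) = (\<Sum>Y\<in>Pow (B - A). (-1) ^ card A * (-1) ^ card Y :: 'a)"
  proof (rule sum.reindex_bij_witness[of _ "\<lambda>Y. A \<union> Y" "\<lambda>X. X - A"])
    fix X assume X: "X \<in> {X. A \<subseteq> X \<and> X \<subseteq> B}"
    then have "card X = card A + card (X - A)"
      using assms by (metis (no_types, lifting) mem_Collect_eq card_Diff_subset card_mono finite_subset
          le_add_diff_inverse)
    then show "(-1) ^ card A * (-1) ^ card (X - A) = ((-1) ^ card X :: 'a)"
      by (simp add: power_add)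
  qed (use assms in auto)
  also have "\<dots> = (-1) ^ card A * (if B - A = {} then 1 else 0)"
    using assms by (subst sum_distrib_left[symmetric], subst sum_Pow_alternating) auto
  finally show ?thesis using assms by auto
qed

lemma sum_compositions_alternating:
  assumes "A \<subseteq> B" "B \<subseteq> {1..<n}"
  shows "(\<Sum>I | I \<in> compositions n \<and> A \<subseteq> Des I \<and> Des I \<subseteq> B. (-1) ^ card (Des I)) =
    (if A = B then (-1) ^ card A else 0 :: 'a::ring_1)"
proof -
  have "Des ` {I \<in> compositions n. A \<subseteq> Des I \<and> Des I \<subseteq> B} =
      {X \<in> Des ` compositions n. A \<subseteq> X \<and> X \<subseteq> B}"
    by blast
  also have "\<dots> = {X. A \<subseteq> X \<and> X \<subseteq> B}"
    using assms by (auto simp: bij_betw_imp_surj_on[OF bij_betw_Des])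
  finally have "bij_betw Des {I \<in> compositions n. A \<subseteq> Des I \<and> Des I \<subseteq> B} {X. A \<subseteq> X \<and> X \<subseteq> B}"
    by (intro bij_betw_subset[OF bij_betw_Des]) auto
  then have "(\<Sum>I | I \<in> compositions n \<and> A \<subseteq> Des I \<and> Des I \<subseteq> B. (-1) ^ card (Des I) :: 'a) =
      (\<Sum>X | A \<subseteq> X \<and> X \<subseteq> B. (-1) ^ card X)"
    by (rule sum.reindex_bij_betw)
  then show ?thesis
    using assms finite_subset[OF assms(2)] by (simp add: sum_interval_alternating)
qed


section \<open>Products of complete and elementary functions in the ribbon basis\<close>

lemma S_prod_plus: "S_prod (I + J) = S_prod I * S_prod J"
  by (simp add: S_prod_def)

lemma S_prod_singleton: "p \<noteq> 0 \<Longrightarrow> S_prod (Composition [p]) = sym_S p"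
  by (simp add: S_prod_def parts_Composition)

text \<open>The sign is split into a factor for \<open>I\<close> and a factor for \<open>J\<close>, so that the sum over \<open>I\<close> can be
  carried out separately when ribbons are added up.\<close>

lemma ribbon_eq:
  assumes "I \<in> compositions n"
  shows "ribbon I = (\<Sum>J | J \<in> compositions n \<and> Des J \<subseteq> Des I.
    (-1) ^ card (Des I) * ((-1) ^ card (Des J) * S_prod J))"
proof -
  have w: "weight I = n" using assms by (simp add: compositions_def)
  have "(-1) ^ (comp_length I - comp_length J) * S_prod J =
      (-1) ^ card (Des I) * ((-1) ^ card (Des J) * S_prod J)"
    if J: "J \<in> compositions n" "Des J \<subseteq> Des I" for J
  proof -
    have "I = 0 \<longleftrightarrow> J = 0"
      using w J by (metis (mono_tags) compositions_def mem_Collect_eq weight_eq_0_iff)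
    then have "comp_length I - comp_length J = card (Des I) - card (Des J)"
      by (cases "I = 0") (simp_all add: comp_length_eq)
    moreover have "card (Des J) \<le> card (Des I)" using J by (simp add: card_mono)
    ultimately show ?thesis by (simp add: minus_one_power_iff)
  qed
  then show ?thesis unfolding ribbon_def w by (intro sum.cong) auto
qed

text \<open>After exchanging the sums, the coefficient of \<open>S\<^sup>J\<close> is an alternating sum over the interval
  from \<open>Des J\<close> to \<open>Des K\<close>, which vanishes unless the interval is a point.\<close>

lemma S_prod_eq_sum_ribbon:
  assumes "K \<in> compositions n"
  shows "S_prod K = (\<Sum>J | J \<in> compositions n \<and> Des J \<subseteq> Des K. ribbon J)"
proof -
  have K: "Des K \<subseteq> {1..<n}" using assms Des_subset[of K] by (simp add: compositions_def)
  have "(\<Sum>I | I \<in> compositions n \<and> Des I \<subseteq> Des K. ribbon I) =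
      (\<Sum>I | I \<in> compositions n \<and> Des I \<subseteq> Des K. \<Sum>J | J \<in> compositions n \<and> Des J \<subseteq> Des I.
        (-1) ^ card (Des I) * ((-1) ^ card (Des J) * S_prod J))"
    by (intro sum.cong refl ribbon_eq) simp
  also have "\<dots> = (\<Sum>J | J \<in> compositions n \<and> Des J \<subseteq> Des K.
      \<Sum>I | I \<in> compositions n \<and> Des J \<subseteq> Des I \<and> Des I \<subseteq> Des K.
        (-1) ^ card (Des I) * ((-1) ^ card (Des J) * S_prod J))"
    by (subst (1 2) sum.Sigma, simp, simp, simp, simp,
        rule sum.reindex_bij_witness[of _ "\<lambda>(x, y). (y, x)" "\<lambda>(x, y). (y, x)"]) auto
  also have "\<dots> = (\<Sum>J | J \<in> compositions n \<and> Des J \<subseteq> Des K.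
      (if Des J = Des K then (-1) ^ card (Des J) else 0) * ((-1) ^ card (Des J) * S_prod J))"
    using K by (intro sum.cong refl)
      (auto simp flip: sum_distrib_right simp: sum_compositions_alternating)
  also have "\<dots> = (\<Sum>J | J \<in> compositions n \<and> Des J \<subseteq> Des K. if J = K then S_prod J else 0)"
    using assms by (intro sum.cong refl)
      (auto simp: minus_one_power_square compositions_def intro: Des_inject)
  also have "\<dots> = S_prod K" using assms by (subst sum.delta) auto
  finally show ?thesis by simp
qed

definition Lambda_prod :: "composition \<Rightarrow> Sym"
  where "Lambda_prod I = prod_list (map sym_Lambda (parts I))"

lemma sym_Lambda_eq_sum_S_prod:
  "sym_Lambda n = (\<Sum>J\<in>compositions n. (-1) ^ (n + comp_length J) * S_prod J)"
proof (induction n rule: less_induct)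
  case (less n)
  show ?case
  proof (cases "n = 0")
    case True
    have "compositions 0 = {0}" by (auto simp: compositions_def)
    then show ?thesis using True by (simp add: sym_Lambda_0 S_prod_def)
  next
    case False
    have "(\<Sum>J\<in>compositions n. (-1) ^ (n + comp_length J) * S_prod J) =
        (\<Sum>(k, J)\<in>(SIGMA k:{..<n}. compositions k).
          (-1) ^ (n + comp_length (J + Composition [n - k])) * S_prod (J + Composition [n - k]))"
      by (subst sum.reindex_bij_betw[OF bij_betw_snoc_compositions[OF False], symmetric])
        (simp add: case_prod_unfold)
    also have "\<dots> = (\<Sum>k<n. \<Sum>J\<in>compositions k.
        (-1) ^ (n + comp_length (J + Composition [n - k])) * S_prod (J + Composition [n - k]))"
      by (subst sum.Sigma) auto
    also have "\<dots> = (\<Sum>k<n. \<Sum>J\<in>compositions k. (-1) ^ (n + 1) *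
        ((-1) ^ k * ((-1) ^ (k + comp_length J) * S_prod J) * sym_S (n - k)))"
      by (intro sum.cong refl) (auto simp: S_prod_plus S_prod_singleton minus_one_power_iff)
    also have "\<dots> = (-1) ^ (n + 1) * (\<Sum>k<n. (-1) ^ k * sym_Lambda k * sym_S (n - k))"
      by (simp add: less sum_distrib_left sum_distrib_right mult.assoc)
    finally show ?thesis using False by (subst sym_Lambda.simps) simp
  qed
qed

text \<open>Multiplying the expansions of the factors concatenates compositions, and \<open>J\<close> is a
  concatenation of compositions of the parts of \<open>K\<close> exactly if every descent of \<open>K\<close> is a descent
  of \<open>J\<close>.\<close>

lemma Lambda_prod_eq_sum_S_prod:
  "Lambda_prod K = (\<Sum>J | J \<in> compositions (weight K) \<and> Des K \<subseteq> Des J.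
    (-1) ^ (weight K + comp_length J) * S_prod J)"
proof (induction K rule: composition_rev_induct)
  case zero
  have "{J \<in> compositions 0. Des 0 \<subseteq> Des J} = {0}" by (auto simp: compositions_def)
  then show ?case by (simp add: Lambda_prod_def S_prod_def)
next
  case (snoc K p)
  show ?case
  proof (cases "K = 0")
    case True
    then show ?thesis using snoc(2) sym_Lambda_eq_sum_S_prod[of p]
      by (simp add: Lambda_prod_def parts_Composition)
  next
    case False
    define m where "m = weight K"
    have m: "m \<noteq> 0" using False by (simp add: m_def)
    have Des: "Des (K + Composition [p]) = insert m (Des K)"
      using False snoc(2) by (simp add: Des_snoc m_def)
    have less: "Des K \<subseteq> {..<m}" using Des_subset[of K] by (auto simp: m_def)
    have sub_iff: "Des K \<subseteq> Des (J + L) \<longleftrightarrow> Des K \<subseteq> Des J"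
      if "J \<in> compositions m" "L \<in> compositions p" for J L
    proof -
      have "L \<noteq> 0" "weight J = m" using that snoc(2) by (auto simp: compositions_def)
      then have "Des (J + L) \<inter> {..<m} = Des J" using Des_plus_less[of L J] by simp
      with less show ?thesis by blast
    qed
    let ?f = "\<lambda>I. (-1) ^ (m + p + comp_length I) * S_prod I"
    have "Lambda_prod (K + Composition [p]) = Lambda_prod K * sym_Lambda p"
      using snoc(2) by (simp add: Lambda_prod_def parts_Composition)
    also have "\<dots> = (\<Sum>J | J \<in> compositions m \<and> Des K \<subseteq> Des J. \<Sum>L\<in>compositions p. ?f (J + L))"
      unfolding snoc.IH sym_Lambda_eq_sum_S_prod[of p] sum_product m_def
      by (intro sum.cong refl) (auto simp: S_prod_plus minus_one_power_iff)
    also have "\<dots> = (\<Sum>(J, L)\<in>compositions m \<times> compositions p.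
        if Des K \<subseteq> Des (J + L) then ?f (J + L) else 0)"
      by (subst sum.Sigma, simp, simp, rule sum.mono_neutral_cong_left)
        (auto simp: sub_iff split: if_splits)
    also have "\<dots> = (\<Sum>I | I \<in> compositions (m + p) \<and> m \<in> Des I. if Des K \<subseteq> Des I then ?f I else 0)"
      by (subst sum.reindex_bij_betw[OF bij_betw_plus_compositions[OF m snoc(2)], symmetric])
        (auto intro: sum.cong)
    also have "\<dots> = (\<Sum>I | I \<in> compositions (m + p) \<and> Des (K + Composition [p]) \<subseteq> Des I. ?f I)"
      by (rule sum.mono_neutral_cong_right) (auto simp: Des)
    finally show ?thesis using snoc(2) by (simp add: m_def)
  qed
qed

text \<open>The coefficient of \<open>S\<^sup>J\<close> on the right is an alternating sum over the interval from
  \<open>({1..<n} - Des K) \<union> Des J\<close> to \<open>{1..<n}\<close>. It vanishes unless \<open>Des K \<subseteq> Des J\<close>, and what remains is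
  the expansion of \<open>\<Lambda>\<^sup>K\<close> over the refinements of \<open>K\<close>.\<close>

lemma Lambda_prod_eq_sum_ribbon:
  assumes K: "K \<in> compositions n"
  shows "Lambda_prod K = (\<Sum>I | I \<in> compositions n \<and> {1..<n} - Des K \<subseteq> Des I. ribbon I)"
proof -
  let ?U = "{1..<n}"
  have w: "weight K = n" using K by (simp add: compositions_def)
  then have KU: "Des K \<subseteq> ?U" using Des_subset[of K] by simp
  have sub: "Des J \<subseteq> ?U" if "J \<in> compositions n" for J
    using that Des_subset[of J] by (simp add: compositions_def)
  have "(\<Sum>I | I \<in> compositions n \<and> ?U - Des K \<subseteq> Des I. ribbon I) =
      (\<Sum>I | I \<in> compositions n \<and> ?U - Des K \<subseteq> Des I. \<Sum>J | J \<in> compositions n \<and> Des J \<subseteq> Des I.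
        (-1) ^ card (Des I) * ((-1) ^ card (Des J) * S_prod J))"
    by (intro sum.cong refl ribbon_eq) simp
  also have "\<dots> = (\<Sum>J\<in>compositions n.
      \<Sum>I | I \<in> compositions n \<and> (?U - Des K) \<union> Des J \<subseteq> Des I \<and> Des I \<subseteq> ?U.
        (-1) ^ card (Des I) * ((-1) ^ card (Des J) * S_prod J))"
    by (subst (1 2) sum.Sigma, simp, simp, simp, simp,
        rule sum.reindex_bij_witness[of _ "\<lambda>(x, y). (y, x)" "\<lambda>(x, y). (y, x)"])
      (use sub in auto)
  also have "\<dots> = (\<Sum>J\<in>compositions n. if Des K \<subseteq> Des J
      then (-1) ^ (n + comp_length J) * S_prod J else 0)"
  proof (rule sum.cong[OF refl])
    fix J assume J: "J \<in> compositions n"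
    have full: "(?U - Des K) \<union> Des J = ?U \<longleftrightarrow> Des K \<subseteq> Des J" using KU sub[OF J] by blast
    have "(-1) ^ card ?U * ((-1) ^ card (Des J) * S_prod J) = (-1) ^ (n + comp_length J) * S_prod J"
    proof (cases "n = 0")
      case True
      then show ?thesis using J by (simp add: compositions_def)
    next
      case False
      then have "J \<noteq> 0" using J by (auto simp: compositions_def)
      then show ?thesis using False by (auto simp: comp_length_eq minus_one_power_iff)
    qed
    then show "(\<Sum>I | I \<in> compositions n \<and> (?U - Des K) \<union> Des J \<subseteq> Des I \<and> Des I \<subseteq> ?U.
        (-1) ^ card (Des I) * ((-1) ^ card (Des J) * S_prod J)) =
      (if Des K \<subseteq> Des J then (-1) ^ (n + comp_length J) * S_prod J else 0)"
      using sub[OF J] full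
      by (subst sum_distrib_right[symmetric], subst sum_compositions_alternating) auto
  qed
  also have "\<dots> = Lambda_prod K"
    using Lambda_prod_eq_sum_S_prod[of K] by (simp add: w sum.inter_filter)
  finally show ?thesis by simp
qed


section \<open>The image of a ribbon\<close>

lemma tensor_sum_left: "sum f A \<otimes> G = (\<Sum>a\<in>A. f a \<otimes> G)"
  by (induction A rule: infinite_finite_induct) (simp_all add: tensor_add_left)

lemma tensor_sum_right: "F \<otimes> sum g B = (\<Sum>b\<in>B. F \<otimes> g b)"
  by (induction B rule: infinite_finite_induct) (simp_all add: tensor_add_right)

lemma hom_Lambda_prod:
  assumes j: "algebra_hom j" "\<And>m. m \<ge> 1 \<Longrightarrow> j (sym_Lambda m) = sym_Lambda m \<otimes> sym_S m"
  shows "j (Lambda_prod K) = Lambda_prod K \<otimes> S_prod K"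
proof (induction K rule: composition_rev_induct)
  case zero
  then show ?case by (simp add: Lambda_prod_def S_prod_def tensor_one algebra_homD[OF j(1)])
next
  case (snoc K p)
  have "Lambda_prod (K + Composition [p]) = Lambda_prod K * sym_Lambda p"
    using snoc(2) by (simp add: Lambda_prod_def parts_Composition)
  with snoc show ?case
    by (simp add: algebra_homD[OF j(1)] j(2) S_prod_plus S_prod_singleton tensor_mult Suc_le_eq)
qed

text \<open>Descending recursion on the descent set: in the equation for \<open>A = Des K\<close>, every summand
  other than the one at \<open>K\<close> belongs to a strictly larger descent set and cancels.\<close>

lemma eq_of_sum_above_eq:
  fixes f g :: "composition \<Rightarrow> 'a::ab_group_add"
  assumes eq: "\<And>A. A \<subseteq> {1..<n} \<Longrightarrow>
      (\<Sum>L | L \<in> compositions n \<and> A \<subseteq> Des L. f L) = (\<Sum>L | L \<in> compositions n \<and> A \<subseteq> Des L. g L)"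
    and K: "K \<in> compositions n"
  shows "f K = g K"
  using K
proof (induction "n - card (Des K)" arbitrary: K rule: less_induct)
  case less
  let ?X = "{L. L \<in> compositions n \<and> Des K \<subseteq> Des L}"
  have sub: "Des L \<subseteq> {1..<n}" if "L \<in> compositions n" for L
    using that Des_subset[of L] by (simp add: compositions_def)
  have "f L = g L" if L: "L \<in> ?X - {K}" for L
  proof -
    have "Des K \<subset> Des L" using L less.prems Des_inject[of K L] by (auto simp: compositions_def)
    then have "card (Des K) < card (Des L)" by (simp add: psubset_card_mono)
    moreover have "card (Des L) \<le> n" using L card_mono[OF _ sub[of L]] by auto
    ultimately show ?thesis using less.hyps[of L] L by auto
  qed
  then have "sum f (?X - {K}) = sum g (?X - {K})" by (rule sum.cong[OF refl])
  moreover have "sum f ?X = sum g ?X" using eq sub less.prems by blast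
  moreover have "K \<in> ?X" "finite ?X" using less.prems by auto
  ultimately show ?case
    using sum.remove[of ?X K f] sum.remove[of ?X K g] by simp
qed

theorem theorem4p1:
  fixes j :: "Sym \<Rightarrow> Sym2" and n :: nat and K :: composition
  assumes "algebra_hom j"
    and "\<And>m. m \<ge> 1 \<Longrightarrow> j (sym_Lambda m) = sym_Lambda m \<otimes> sym_S m"
    and "K \<in> compositions n"
  shows "j (ribbon K) =
    (\<Sum>(I, J)\<in>{(I, J). I \<in> compositions n \<and> J \<in> compositions n \<and> Des I - Des J = Des K}.
      ribbon I \<otimes> ribbon J)"
proof (rule eq_of_sum_above_eq[where K = K and n = n])
  fix A :: "nat set" assume A: "A \<subseteq> {1..<n}"
  let ?P = "\<lambda>L. {(I, J). I \<in> compositions n \<and> J \<in> compositions n \<and> Des I - Des J = Des L}"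
  (* The product of elementary functions for M is the sum of the ribbons whose descents contain A. *)
  obtain M where M: "M \<in> compositions n" "Des M = {1..<n} - A"
    using Des_surj[of "{1..<n} - A" n] by (auto simp: compositions_def)
  then have A_eq: "{1..<n} - Des M = A" using A by auto
  have sub: "Des L \<subseteq> {1..<n}" if "L \<in> compositions n" for L
    using that Des_subset[of L] by (simp add: compositions_def)
  have fin: "finite (?P L)" for L
    by (rule finite_subset[of _ "compositions n \<times> compositions n"]) auto
  have "(\<Sum>L | L \<in> compositions n \<and> A \<subseteq> Des L. j (ribbon L)) = j (Lambda_prod M)"
    unfolding Lambda_prod_eq_sum_ribbon[OF M(1)] A_eq by (simp add: algebra_homD[OF assms(1)])
  also have "\<dots> = Lambda_prod M \<otimes> S_prod M"
    by (rule hom_Lambda_prod[OF assms(1,2)])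
  also have "\<dots> = (\<Sum>I | I \<in> compositions n \<and> A \<subseteq> Des I.
      \<Sum>J | J \<in> compositions n \<and> Des J \<subseteq> {1..<n} - A. ribbon I \<otimes> ribbon J)"
    unfolding Lambda_prod_eq_sum_ribbon[OF M(1)] S_prod_eq_sum_ribbon[OF M(1)] A_eq
    unfolding M(2) tensor_sum_left unfolding tensor_sum_right by (rule refl)
  also have "\<dots> = (\<Sum>(I, J) | I \<in> compositions n \<and> J \<in> compositions n \<and> A \<subseteq> Des I - Des J.
      ribbon I \<otimes> ribbon J)"
  proof -
    have "(SIGMA I:{I. I \<in> compositions n \<and> A \<subseteq> Des I}.
        {J. J \<in> compositions n \<and> Des J \<subseteq> {1..<n} - A}) =
      {(I, J). I \<in> compositions n \<and> J \<in> compositions n \<and> A \<subseteq> Des I - Des J}"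
      using sub by blast
    then show ?thesis by (subst sum.Sigma) simp_all
  qed
  also have "\<dots> = (\<Sum>(I, J)\<in>(\<Union>L\<in>{L. L \<in> compositions n \<and> A \<subseteq> Des L}. ?P L). ribbon I \<otimes> ribbon J)"
  proof (rule sum.cong[OF _ refl])
    have "\<exists>L. L \<in> compositions n \<and> Des I - Des J = Des L" if "I \<in> compositions n" for I J
      using Des_surj[of "Des I - Des J" n] sub[OF that] by (auto simp: compositions_def)
    then show "{(I, J). I \<in> compositions n \<and> J \<in> compositions n \<and> A \<subseteq> Des I - Des J} =
        (\<Union>L\<in>{L. L \<in> compositions n \<and> A \<subseteq> Des L}. ?P L)"
      by fastforce
  qed
  also have "\<dots> = (\<Sum>L | L \<in> compositions n \<and> A \<subseteq> Des L. \<Sum>(I, J)\<in>?P L. ribbon I \<otimes> ribbon J)"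
  proof (rule sum.UNION_disjoint)
    have "L = L'" if "L \<in> compositions n" "L' \<in> compositions n" "Des L = Des L'" for L L'
      using that Des_inject by (auto simp: compositions_def)
    then show "\<forall>L\<in>{L. L \<in> compositions n \<and> A \<subseteq> Des L}. \<forall>L'\<in>{L. L \<in> compositions n \<and> A \<subseteq> Des L}.
        L \<noteq> L' \<longrightarrow> ?P L \<inter> ?P L' = {}"
      by auto
  qed (use fin in auto)
  finally show "(\<Sum>L | L \<in> compositions n \<and> A \<subseteq> Des L. j (ribbon L)) =
      (\<Sum>L | L \<in> compositions n \<and> A \<subseteq> Des L. \<Sum>(I, J)\<in>?P L. ribbon I \<otimes> ribbon J)" .
qed (rule assms(3))

end
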